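(* Let $p>1$ and $N\ge 2m-1$. For almost all $(A,y)\in\mathbb R^{m\times N}\times\mathbb R^m$, the unique optimal solution $x^*$ of $\min_{x\in\mathbb R^N}\|x\|_p$ subject to $Ax=y$ satisfies $|\mathrm{supp}(x^* )|=N$.
   Context: $\|x\|_p:=(\sum_i|x_i|^p)^{1/p}$; $\mathrm{supp}(x)=\{i:x_i\ne0\}$. "For almost all" means outside a set of Lebesgue measure zero. *)

theory Defs
  imports "HOL-Analysis.Analysis"
begin

text \<open>The p-norm on real vectors indexed by a finite type.\<close>
definition pnorm :: "real \<Rightarrow> real ^ 'n \<Rightarrow> real" where
  "pnorm p x = (\<Sum>i\<in>UNIV. \<bar>x $ i\<bar> powr p) powr (1 / p)"

text \<open>Support of a vector.\<close>
definition supp :: "real ^ 'n \<Rightarrow> 'n set" where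
  "supp x = {i. x $ i \<noteq> 0}"

text \<open>x is an optimal solution of  min ||x||_p  subject to  A x = y.\<close>
definition lp_optimal :: "real \<Rightarrow> real ^ 'n ^ 'm \<Rightarrow> real ^ 'm \<Rightarrow> real ^ 'n \<Rightarrow> bool" where
  "lp_optimal p A y x \<longleftrightarrow>
     A *v x = y \<and> (\<forall>z. A *v z = y \<longrightarrow> pnorm p x \<le> pnorm p z)"

end

theory Submission
  imports Defs
begin

text \<open>
  For p > 1 the function \<open>x \<mapsto> \<Sum>j. \<bar>x j\<bar> powr p\<close> is strictly convex and coercive, so as
  soon as \<open>A x = y\<close> is solvable it has exactly one minimizer x on that affine space, and the
  first-order condition says that the vector of signed powers \<open>sgn (x j) * \<bar>x j\<bar> powr (p - 1)\<close>
  is \<open>l v* A\<close> for a multiplier l. If l = 0 then x = 0, so y = 0. Otherwise some \<open>l k \<noteq> 0\<close>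
  and the condition can be solved for row k of A. Hence the pairs (A, A x) coming from a
  minimizer with a zero entry are the image of a hyperplane under a differentiable map between
  spaces of equal dimension, and so form a null set. The same device shows that, when m \<le> N,
  the matrices whose rows are linearly dependent form a null set; for all other pairs with
  y \<noteq> 0 the system is solvable and its minimizer has full support.
\<close>

section \<open>Signed powers\<close>

definition signed_powr :: "real \<Rightarrow> real \<Rightarrow> real" where
  "signed_powr b u = sgn u * \<bar>u\<bar> powr b"

lemma signed_powr_0 [simp]: "signed_powr b 0 = 0"
  by (simp add: signed_powr_def)

lemma signed_powr_eq_0_iff [simp]: "signed_powr b u = 0 \<longleftrightarrow> u = 0"
  by (auto simp: signed_powr_def sgn_if)

lemma signed_powr_1 [simp]: "signed_powr 1 u = u"
  by (auto simp: signed_powr_def sgn_if)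

lemma abs_signed_powr: "\<bar>signed_powr b u\<bar> = \<bar>u\<bar> powr b"
  by (auto simp: signed_powr_def abs_mult sgn_if)

lemma signed_powr_signed_powr: "signed_powr b (signed_powr c u) = signed_powr (c * b) u"
  by (auto simp: signed_powr_def sgn_if abs_mult powr_powr)

lemma signed_powr_eq_mult_abs_powr: "signed_powr b u = u * \<bar>u\<bar> powr (b - 1)"
  by (cases "u = 0") (auto simp: signed_powr_def sgn_if powr_diff)

lemma strict_mono_signed_powr:
  assumes "b > 0"
  shows "strict_mono (signed_powr b)"
proof (rule strict_monoI)
  fix u v :: real
  assume "u < v"
  then consider "0 \<le> u" | "u < 0" "0 \<le> v" | "v < 0"
    by linarith
  then show "signed_powr b u < signed_powr b v"
  proof cases
    case 2
    then have "signed_powr b u < 0" "0 \<le> signed_powr b v"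
      by (auto simp: signed_powr_def)
    then show ?thesis
      by linarith
  qed (use \<open>u < v\<close> assms in \<open>auto simp: signed_powr_def sgn_if powr_less_mono2\<close>)
qed

lemma strict_mono_diff_mult_nonneg:
  fixes f :: "real \<Rightarrow> real"
  assumes "strict_mono f"
  shows "(f u - f v) * (u - v) \<ge> 0"
  using strict_monoD[OF assms, of u v] strict_monoD[OF assms, of v u]
  by (cases u v rule: linorder_cases) (auto simp: mult_nonpos_nonpos)

lemma strict_mono_diff_mult_eq_0_iff:
  fixes f :: "real \<Rightarrow> real"
  assumes "strict_mono f"
  shows "(f u - f v) * (u - v) = 0 \<longleftrightarrow> u = v"
  using strict_monoD[OF assms, of u v] strict_monoD[OF assms, of v u]
  by (cases u v rule: linorder_cases) auto

lemma has_real_derivative_0_if_abs_eq_powr: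
  fixes f :: "real \<Rightarrow> real"
  assumes "c > 1" and f: "\<And>h. \<bar>f h\<bar> = \<bar>h\<bar> powr c"
  shows "(f has_real_derivative 0) (at 0)"
  unfolding DERIV_def
proof -
  have "((\<lambda>h. \<bar>h\<bar> powr (c - 1)) \<longlongrightarrow> 0 powr (c - 1)) (at 0)"
    using assms by (intro tendsto_powr') (auto intro!: tendsto_eq_intros)
  then have "((\<lambda>h. \<bar>h\<bar> powr (c - 1)) \<longlongrightarrow> 0) (at 0)"
    by simp
  moreover have "f 0 = 0"
    using f[of 0] by simp
  then have "\<forall>\<^sub>F h in at 0. \<bar>h\<bar> powr (c - 1) = \<bar>(f (0 + h) - f 0) / h\<bar>"
    unfolding eventually_at_filter by (auto simp: f abs_divide powr_diff)
  ultimately have "((\<lambda>h. \<bar>(f (0 + h) - f 0) / h\<bar>) \<longlongrightarrow> 0) (at 0)"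
    by (rule Lim_transform_eventually)
  then show "((\<lambda>h. (f (0 + h) - f 0) / h) \<longlongrightarrow> 0) (at 0)"
    by (simp only: tendsto_rabs_zero_iff)
qed

lemma has_real_derivative_abs_powr_nonzero:
  assumes "s \<noteq> 0"
  shows "((\<lambda>x. \<bar>x\<bar> powr c) has_real_derivative c * signed_powr (c - 1) s) (at s)"
proof (cases "s > 0")
  case True
  have "((\<lambda>x. x powr c) has_real_derivative c * s powr (c - 1)) (at s)"
    using has_real_derivative_powr[OF True] .
  then have "((\<lambda>x. \<bar>x\<bar> powr c) has_real_derivative c * s powr (c - 1)) (at s)"
    by (rule has_field_derivative_transform_within_open[where S="{0<..}"]) (use True in auto)
  then show ?thesis
    using True by (simp add: signed_powr_def)
next
  case False
  then have "s < 0"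
    using assms by simp
  have "((\<lambda>x. (- x) powr c) has_real_derivative c * (- s) powr (c - 1) * (- 1)) (at s)"
    using \<open>s < 0\<close> by (auto intro!: derivative_eq_intros)
  then have "((\<lambda>x. \<bar>x\<bar> powr c) has_real_derivative c * (- s) powr (c - 1) * (- 1)) (at s)"
    by (rule has_field_derivative_transform_within_open[where S="{..<0}"]) (use \<open>s < 0\<close> in auto)
  then show ?thesis
    using \<open>s < 0\<close> by (simp add: signed_powr_def)
qed

lemma has_real_derivative_abs_powr:
  assumes "c > 1"
  shows "((\<lambda>x. \<bar>x\<bar> powr c) has_real_derivative c * signed_powr (c - 1) s) (at s)"
  using has_real_derivative_abs_powr_nonzero[of s c]
    has_real_derivative_0_if_abs_eq_powr[OF assms, of "\<lambda>x. \<bar>x\<bar> powr c"]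
  by (cases "s = 0") auto

lemma differentiable_signed_powr:
  assumes "b \<ge> 1"
  shows "signed_powr b differentiable (at u)"
proof -
  consider "b = 1" | "b > 1" "u = 0" | "u \<noteq> 0"
    using assms by fastforce
  then show ?thesis
  proof cases
    case 1
    have "signed_powr 1 = (\<lambda>u. u)"
      by (rule ext) simp
    then show ?thesis
      using 1 by simp
  next
    case 2
    then show ?thesis
      using has_real_derivative_0_if_abs_eq_powr[of b "signed_powr b"]
      by (auto simp: abs_signed_powr real_differentiable_def)
  next
    case 3
    have "(\<lambda>u. u * \<bar>u\<bar> powr (b - 1)) differentiable (at u)"
      using DERIV_mult[OF DERIV_ident has_real_derivative_abs_powr_nonzero[OF 3]]
      by (auto simp: real_differentiable_def)
    then show ?thesis
      by (simp add: signed_powr_eq_mult_abs_powr[abs_def])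
  qed
qed

lemma differentiable_compose_signed_powr [derivative_intros]:
  "b \<ge> 1 \<Longrightarrow> f differentiable (at w) \<Longrightarrow> (\<lambda>z. signed_powr b (f z)) differentiable (at w)"
  by (rule differentiable_compose[OF differentiable_signed_powr])

section \<open>Minimizers of the p-norm on the fibres of a matrix\<close>

definition sum_abs_powr :: "real \<Rightarrow> real ^ 'n \<Rightarrow> real" where
  "sum_abs_powr p x = (\<Sum>i\<in>UNIV. \<bar>x $ i\<bar> powr p)"

definition is_lp_minimizer :: "real \<Rightarrow> real ^ 'n ^ 'm \<Rightarrow> real ^ 'n \<Rightarrow> bool" where
  "is_lp_minimizer p A x \<longleftrightarrow>
     (\<forall>z. A *v z = A *v x \<longrightarrow> sum_abs_powr p x \<le> sum_abs_powr p z)"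

lemma powr_le_powr_iff:
  fixes a b r :: real
  assumes "0 \<le> a" "0 \<le> b" "r > 0"
  shows "a powr r \<le> b powr r \<longleftrightarrow> a \<le> b"
  using assms powr_less_mono2[of r b a] powr_mono2[of r a b] by (cases "a \<le> b") auto

lemma lp_optimal_iff_is_lp_minimizer:
  assumes "p > 0"
  shows "lp_optimal p A y x \<longleftrightarrow> A *v x = y \<and> is_lp_minimizer p A x"
proof -
  have "sum_abs_powr p x powr (1 / p) \<le> sum_abs_powr p z powr (1 / p) \<longleftrightarrow>
        sum_abs_powr p x \<le> sum_abs_powr p z" for z
    using assms by (intro powr_le_powr_iff) (auto simp: sum_abs_powr_def sum_nonneg)
  then show ?thesis
    unfolding lp_optimal_def is_lp_minimizer_def pnorm_def sum_abs_powr_def[symmetric] by auto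
qed

lemma continuous_on_sum_abs_powr: "p > 0 \<Longrightarrow> continuous_on S (sum_abs_powr p)"
  unfolding sum_abs_powr_def by (intro continuous_intros continuous_on_powr') auto

lemma abs_le_sum_abs_powr:
  assumes "p > 0"
  shows "\<bar>x $ i\<bar> \<le> sum_abs_powr p x powr (1 / p)"
proof -
  have "\<bar>x $ i\<bar> powr p \<le> sum_abs_powr p x"
    unfolding sum_abs_powr_def by (rule member_le_sum) auto
  then have "(\<bar>x $ i\<bar> powr p) powr (1 / p) \<le> sum_abs_powr p x powr (1 / p)"
    using assms by (intro powr_mono2) auto
  then show ?thesis
    using assms by (simp add: powr_powr)
qed

lemma lp_minimizer_exists:
  fixes A :: "real ^ 'n ^ 'm"
  assumes "p > 0"
  shows "\<exists>x. A *v x = A *v x0 \<and> is_lp_minimizer p A x"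
proof -
  define K where "K = {x. A *v x = A *v x0} \<inter> {x. sum_abs_powr p x \<le> sum_abs_powr p x0}"
  have "closed K"
    unfolding K_def using continuous_on_sum_abs_powr[OF assms]
    by (intro closed_Int closed_Collect_eq closed_Collect_le) (auto intro: continuous_intros)
  moreover have "bounded K"
    unfolding bounded_iff
  proof (intro exI ballI)
    fix x
    assume "x \<in> K"
    then have "sum_abs_powr p x powr (1 / p) \<le> sum_abs_powr p x0 powr (1 / p)"
      using assms unfolding K_def by (auto intro: powr_mono2 simp: sum_abs_powr_def sum_nonneg)
    then have "\<bar>x $ i\<bar> \<le> sum_abs_powr p x0 powr (1 / p)" for i
      using abs_le_sum_abs_powr[OF assms, of x i] by linarith
    then have "(\<Sum>i\<in>UNIV. \<bar>x $ i\<bar>) \<le> (\<Sum>i\<in>(UNIV :: 'n set). sum_abs_powr p x0 powr (1 / p))"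
      by (intro sum_mono)
    then show "norm x \<le> real CARD('n) * sum_abs_powr p x0 powr (1 / p)"
      using norm_le_l1_cart[of x] by simp
  qed
  ultimately have "compact K"
    by (simp add: compact_eq_bounded_closed)
  moreover have "K \<noteq> {}"
    unfolding K_def by auto
  ultimately obtain x where "x \<in> K" and min: "\<And>z. z \<in> K \<Longrightarrow> sum_abs_powr p x \<le> sum_abs_powr p z"
    using continuous_attains_inf[OF _ _ continuous_on_sum_abs_powr[OF assms]] by metis
  have "sum_abs_powr p x \<le> sum_abs_powr p z" if "A *v z = A *v x0" for z
  proof (cases "z \<in> K")
    case False
    then show ?thesis
      using \<open>x \<in> K\<close> that by (auto simp: K_def)
  qed (rule min)
  then show ?thesis
    using \<open>x \<in> K\<close> unfolding is_lp_minimizer_def K_def by auto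
qed

lemma lp_minimizer_orthogonal_null_space:
  fixes A :: "real ^ 'n ^ 'm"
  assumes "p > 1" and min: "is_lp_minimizer p A x" and "A *v v = 0"
  shows "(\<chi> j. signed_powr (p - 1) (x $ j)) \<bullet> v = 0"
proof -
  define g where "g t = sum_abs_powr p (x + t *\<^sub>R v)" for t
  have "(g has_real_derivative (\<Sum>j\<in>UNIV. p * signed_powr (p - 1) (x $ j) * v $ j)) (at 0)"
    unfolding g_def sum_abs_powr_def
  proof (intro DERIV_sum)
    fix j
    have "((\<lambda>t. x $ j + t * v $ j) has_real_derivative v $ j) (at 0)"
      by (auto intro!: derivative_eq_intros)
    from DERIV_chain2[OF has_real_derivative_abs_powr[OF \<open>p > 1\<close>] this]
    show "((\<lambda>t. \<bar>(x + t *\<^sub>R v) $ j\<bar> powr p) has_real_derivative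
           p * signed_powr (p - 1) (x $ j) * v $ j) (at 0)"
      by simp
  qed
  moreover have "g 0 \<le> g t" for t
    using min \<open>A *v v = 0\<close> unfolding g_def is_lp_minimizer_def
    by (simp add: matrix_vector_right_distrib matrix_vector_mult_scaleR)
  ultimately have "(\<Sum>j\<in>UNIV. p * signed_powr (p - 1) (x $ j) * v $ j) = 0"
    using DERIV_local_min[of g _ 0 1] by auto
  then show ?thesis
    using \<open>p > 1\<close> by (simp add: inner_vec_def mult.assoc flip: sum_distrib_left)
qed

lemma orthogonal_null_space_imp_row_combination:
  fixes A :: "real ^ 'n ^ 'm"
  assumes "\<And>v. A *v v = 0 \<Longrightarrow> w \<bullet> v = 0"
  shows "\<exists>l. w = l v* A"
proof -
  let ?S = "range (\<lambda>l. transpose A *v l)"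
  have "subspace ?S"
    by (rule linear_subspace_image[OF matrix_vector_mul_linear subspace_UNIV])
  obtain a z where a: "a \<in> span ?S" and z: "\<And>u. u \<in> span ?S \<Longrightarrow> orthogonal z u"
    and "w = a + z"
    using orthogonal_subspace_decomp_exists by blast
  have "(A *v z) \<bullet> (A *v z) = z \<bullet> ((A *v z) v* A)"
    by (metis dot_lmul_matrix inner_commute)
  also have "\<dots> = 0"
    using z[of "(A *v z) v* A"] by (auto simp: orthogonal_def span_base)
  finally have "w \<bullet> z = 0"
    using assms by simp
  moreover have "a \<bullet> z = 0"
    using z[OF a] by (simp add: orthogonal_def inner_commute)
  ultimately have "z = 0"
    using \<open>w = a + z\<close> by (simp add: inner_add_left)
  then have "w \<in> ?S"
    using a \<open>w = a + z\<close> span_eq_iff[THEN iffD2, OF \<open>subspace ?S\<close>] by (simp del: transpose_matrix_vector)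
  then show ?thesis
    by auto
qed

lemma lp_minimizer_kkt:
  fixes A :: "real ^ 'n ^ 'm"
  assumes "p > 1" "is_lp_minimizer p A x"
  obtains l where "(\<chi> j. signed_powr (p - 1) (x $ j)) = l v* A"
  using orthogonal_null_space_imp_row_combination lp_minimizer_orthogonal_null_space[OF assms]
  by blast

lemma lp_minimizer_unique:
  fixes A :: "real ^ 'n ^ 'm"
  assumes "p > 1" "is_lp_minimizer p A x" "is_lp_minimizer p A z" "A *v z = A *v x"
  shows "z = x"
proof -
  define gx gz where "gx = (\<chi> j. signed_powr (p - 1) (x $ j))" and "gz = (\<chi> j. signed_powr (p - 1) (z $ j))"
  have mono: "strict_mono (signed_powr (p - 1))"
    using assms(1) by (simp add: strict_mono_signed_powr)
  have "gx \<bullet> (z - x) = 0" "gz \<bullet> (x - z) = 0"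
    unfolding gx_def gz_def using assms
    by (auto intro!: lp_minimizer_orthogonal_null_space simp: matrix_vector_mult_diff_distrib)
  then have "(gz - gx) \<bullet> (z - x) = 0"
    by (simp add: inner_diff algebra_simps)
  then have "(\<Sum>j\<in>UNIV. (signed_powr (p - 1) (z $ j) - signed_powr (p - 1) (x $ j)) * (z $ j - x $ j)) = 0"
    by (simp add: gx_def gz_def inner_vec_def)
  then have "\<forall>j\<in>UNIV. (signed_powr (p - 1) (z $ j) - signed_powr (p - 1) (x $ j)) * (z $ j - x $ j) = 0"
    by (subst (asm) sum_nonneg_eq_0_iff) (auto intro: strict_mono_diff_mult_nonneg[OF mono])
  then have "z $ j = x $ j" for j
    using strict_mono_diff_mult_eq_0_iff[OF mono] by blast
  then show ?thesis
    by (simp add: vec_eq_iff)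
qed

section \<open>Negligible sets\<close>

lemma differentiable_vec_nth [derivative_intros]:
  "f differentiable F \<Longrightarrow> (\<lambda>z. f z $ i) differentiable F"
  unfolding differentiable_def using bounded_linear.has_derivative[OF bounded_linear_vec_nth] by blast

lemma differentiable_fst [derivative_intros]:
  "f differentiable F \<Longrightarrow> (\<lambda>z. fst (f z)) differentiable F"
  unfolding differentiable_def using has_derivative_fst by blast

lemma differentiable_snd [derivative_intros]:
  "f differentiable F \<Longrightarrow> (\<lambda>z. snd (f z)) differentiable F"
  unfolding differentiable_def using has_derivative_snd by blast

lemma differentiable_if_const [derivative_intros]:
  "f differentiable F \<Longrightarrow> g differentiable F \<Longrightarrow> (\<lambda>z. if P then f z else g z) differentiable F"
  by (cases P) simp_all

lemma differentiable_vec_lambda [derivative_intros]: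
  assumes "\<And>i. f i differentiable (at w)"
  shows "(\<lambda>z. (\<chi> i. f i z) :: 'b::euclidean_space ^ 'i) differentiable (at w)"
proof -
  have "(\<lambda>z. \<Sum>i\<in>UNIV. axis i (f i z) :: 'b ^ 'i) differentiable (at w)"
  proof (intro differentiable_sum ballI finite)
    fix i
    have "bounded_linear (axis i :: 'b \<Rightarrow> 'b ^ 'i)"
      by (simp add: linear_conv_bounded_linear[symmetric] linearI axis_def vec_eq_iff)
    then show "(\<lambda>z. axis i (f i z) :: 'b ^ 'i) differentiable (at w)"
      using assms unfolding differentiable_def by (blast intro: bounded_linear.has_derivative)
  qed
  moreover have "(\<lambda>z. \<Sum>i\<in>UNIV. axis i (f i z) :: 'b ^ 'i) = (\<lambda>z. \<chi> i. f i z)"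
    by (simp add: fun_eq_iff vec_eq_iff axis_def sum_component if_distrib cong: if_cong)
  ultimately show ?thesis
    by simp
qed

lemma negligible_entry_eq_0:
  "negligible {z :: (real ^ 'n ^ 'm) \<times> 'b::euclidean_space. fst z $ k $ i = 0}"
proof -
  let ?e = "(axis k (axis i 1), 0) :: (real ^ 'n ^ 'm) \<times> 'b"
  have "?e \<noteq> 0"
    by (simp add: zero_prod_def axis_eq_0_iff)
  moreover have "?e \<bullet> z = fst z $ k $ i" for z
    by (cases z) (simp add: inner_axis')
  ultimately show ?thesis
    using negligible_hyperplane[of ?e 0] by simp
qed

lemma negligible_differentiable_image_entry_slice:
  fixes f :: "(real ^ 'n ^ 'm) \<times> 'b::euclidean_space \<Rightarrow> (real ^ 'n ^ 'm) \<times> 'b"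
  assumes "f differentiable_on S" and "\<And>z. z \<in> S \<Longrightarrow> fst z $ k $ i = 0"
  shows "negligible (f ` S)"
  using assms
  by (intro negligible_differentiable_image_negligible negligible_subset[OF negligible_entry_eq_0]) auto

lemma AE_lborel_if_negligible:
  assumes "negligible N" and "\<And>x. x \<notin> N \<Longrightarrow> P x"
  shows "AE x in (lborel :: 'a::euclidean_space measure). P x"
proof -
  have "AE x in (lebesgue :: 'a measure). P x"
    unfolding eventually_ae_filter_negligible using assms by blast
  then show ?thesis
    by (simp add: AE_completion_iff)
qed

lemma negligible_snd_eq_0:
  "negligible {z :: 'a::euclidean_space \<times> 'b::euclidean_space. snd z = 0}"
proof -
  obtain b :: 'b where "b \<in> Basis"
    using nonempty_Basis by blast
  then have "negligible {z :: 'a \<times> 'b. (0, b) \<bullet> z = 0}"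
    by (intro negligible_hyperplane) (auto simp: zero_prod_def nonzero_Basis)
  then show ?thesis
    by (rule negligible_subset) auto
qed

section \<open>Matrices with dependent rows\<close>

text \<open>
  Row k is replaced by a combination of the other rows whose coefficients are read off the
  entries \<open>B $ k $ g r\<close>, g injective; the entry \<open>B $ k $ g k\<close> is not used, so every
  matrix with dependent rows lies in the image of the hyperplane on which it vanishes.
\<close>
definition dependent_row_matrix :: "('m \<Rightarrow> 'n) \<Rightarrow> 'm \<Rightarrow> real ^ 'n ^ 'm \<Rightarrow> real ^ 'n ^ 'm" where
  "dependent_row_matrix g k B =
     (\<chi> r j. if r = k then - (\<Sum>r'\<in>UNIV - {k}. B $ k $ g r' * B $ r' $ j) else B $ r $ j)"

lemma non_surjective_in_dependent_row_matrix_image: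
  fixes A :: "real ^ 'n ^ 'm" and g :: "'m \<Rightarrow> 'n"
  assumes "inj g" and "\<not> surj ((*v) A)"
  obtains k where "A \<in> dependent_row_matrix g k ` {B. B $ k $ g k = 0}"
proof -
  have "rank (transpose A) \<noteq> CARD('m)"
    using assms(2) by (simp add: rank_transpose full_rank_surjective)
  then obtain l where "l \<noteq> 0" and "l v* A = 0"
    using matrix_nonfull_linear_equations_eq[of "transpose A"] by auto
  then obtain k where "l $ k \<noteq> 0"
    by (auto simp: vec_eq_iff)
  define B where "B = (\<chi> r j. if r = k then (if j \<in> range g \<and> inv g j \<noteq> k then l $ inv g j / l $ k else 0)
                                else A $ r $ j)"
  have "(\<Sum>r\<in>UNIV. l $ r * A $ r $ j) = 0" for j
    using \<open>l v* A = 0\<close> by (auto simp: vec_eq_iff vector_matrix_mult_def mult.commute)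
  then have row_k: "A $ k $ j = - (\<Sum>r\<in>UNIV - {k}. l $ r * A $ r $ j) / l $ k" for j
    using \<open>l $ k \<noteq> 0\<close> by (simp add: sum.remove[of UNIV k] field_simps eq_neg_iff_add_eq_0)
  have "(\<Sum>r\<in>UNIV - {k}. B $ k $ g r * B $ r $ j) = (\<Sum>r\<in>UNIV - {k}. l $ r * A $ r $ j) / l $ k" for j
    unfolding sum_divide_distrib using \<open>inj g\<close> by (intro sum.cong) (auto simp: B_def)
  then have "dependent_row_matrix g k B $ r $ j = A $ r $ j" for r j
    using row_k by (cases "r = k") (simp_all add: dependent_row_matrix_def B_def)
  then have "A = dependent_row_matrix g k B"
    by (simp add: vec_eq_iff)
  moreover have "B $ k $ g k = 0"
    using \<open>inj g\<close> by (simp add: B_def)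
  ultimately show ?thesis
    by (intro that[of k] image_eqI[of _ _ B]) simp_all
qed

lemma negligible_non_surjective:
  assumes "CARD('m::finite) \<le> CARD('n::finite)"
  shows "negligible {z :: (real ^ 'n ^ 'm) \<times> 'b::euclidean_space. \<not> surj ((*v) (fst z))}"
proof -
  obtain g :: "'m \<Rightarrow> 'n" where "inj g"
    using card_le_inj[OF finite finite assms] by blast
  define chart where "chart k z = (dependent_row_matrix g k (fst z), snd z)" for k and z :: "(real ^ 'n ^ 'm) \<times> 'b"
  have "{z. \<not> surj ((*v) (fst z))} \<subseteq> (\<Union>k. chart k ` {z. fst z $ k $ g k = 0})"
  proof
    fix z :: "(real ^ 'n ^ 'm) \<times> 'b"
    assume "z \<in> {z. \<not> surj ((*v) (fst z))}"
    then have "\<not> surj ((*v) (fst z))"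
      by simp
    then obtain k where "fst z \<in> dependent_row_matrix g k ` {B. B $ k $ g k = 0}"
      by (rule non_surjective_in_dependent_row_matrix_image[OF \<open>inj g\<close>])
    then obtain B where "fst z = dependent_row_matrix g k B" "B $ k $ g k = 0"
      by auto
    then have "z = chart k (B, snd z)"
      by (simp add: chart_def prod_eq_iff)
    then show "z \<in> (\<Union>k. chart k ` {z. fst z $ k $ g k = 0})"
      using \<open>B $ k $ g k = 0\<close> by (intro UN_I[OF UNIV_I] image_eqI) auto
  qed
  moreover have "negligible (chart k ` {z. fst z $ k $ g k = 0})" for k
  proof (rule negligible_differentiable_image_entry_slice)
    show "chart k differentiable_on {z. fst z $ k $ g k = 0}"
      unfolding chart_def dependent_row_matrix_def
      by (intro differentiable_at_imp_differentiable_on) (auto intro!: derivative_intros)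
  next
    show "\<And>z. z \<in> {z. fst z $ k $ g k = 0} \<Longrightarrow> fst z $ k $ g k = 0" by simp
  qed
  then have "negligible (\<Union>k. chart k ` {z. fst z $ k $ g k = 0})"
    by (intro negligible_Union finite_imageI finite) auto
  ultimately show ?thesis
    by (rule negligible_subset[rotated])
qed

section \<open>Data with a sparse minimizer\<close>

text \<open>
  Row k of B stores \<open>signed_powr (1 / a) x\<close>, so that both \<open>x = signed_powr a (B $ k)\<close> and the
  gradient \<open>signed_powr (a * (p - 1)) (B $ k)\<close> are differentiable in B once a and a (p - 1)
  are at least 1; row k of A is then solved from the multiplier rule, with \<open>l $ k \<noteq> 0\<close>.
\<close>
definition kkt_matrix :: "real \<Rightarrow> 'm \<Rightarrow> real ^ 'n ^ 'm \<Rightarrow> real ^ 'm \<Rightarrow> real ^ 'n ^ 'm" where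
  "kkt_matrix b k B l =
     (\<chi> r j. if r = k then (signed_powr b (B $ k $ j) - (\<Sum>r'\<in>UNIV - {k}. l $ r' * B $ r' $ j)) / l $ k
             else B $ r $ j)"

definition kkt_chart ::
    "real \<Rightarrow> real \<Rightarrow> 'm \<Rightarrow> (real ^ 'n ^ 'm) \<times> (real ^ 'm) \<Rightarrow> (real ^ 'n ^ 'm) \<times> (real ^ 'm)"
  where
  "kkt_chart a b k z =
     (kkt_matrix b k (fst z) (snd z), kkt_matrix b k (fst z) (snd z) *v (\<chi> j. signed_powr a (fst z $ k $ j)))"

definition sparse_kkt_pairs :: "real \<Rightarrow> ((real ^ 'n ^ 'm) \<times> (real ^ 'm)) set" where
  "sparse_kkt_pairs p =
     {(A, A *v x) | A x l. l \<noteq> 0 \<and> (\<chi> j. signed_powr (p - 1) (x $ j)) = l v* A \<and> (\<exists>i. x $ i = 0)}"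

lemma differentiable_on_kkt_chart:
  assumes "a \<ge> 1" "b \<ge> 1"
  shows "kkt_chart a b k differentiable_on {z. snd z $ k \<noteq> 0}"
  unfolding kkt_chart_def kkt_matrix_def matrix_vector_mult_def
  using assms by (intro differentiable_at_imp_differentiable_on) (auto intro!: derivative_intros)

lemma sparse_kkt_pair_in_kkt_chart_image:
  fixes A :: "real ^ 'n ^ 'm"
  assumes "a > 0" "x $ i = 0" "l $ k \<noteq> 0" and kkt: "(\<chi> j. signed_powr (p - 1) (x $ j)) = l v* A"
  shows "(A, A *v x) \<in> kkt_chart a (a * (p - 1)) k ` {z. fst z $ k $ i = 0 \<and> snd z $ k \<noteq> 0}"
proof -
  define B where "B = (\<chi> r j. if r = k then signed_powr (1 / a) (x $ j) else A $ r $ j)"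
  have row_k: "signed_powr (a * (p - 1)) (B $ k $ j) = l $ k * A $ k $ j + (\<Sum>r\<in>UNIV - {k}. l $ r * A $ r $ j)" for j
    using \<open>a > 0\<close> arg_cong[OF kkt, of "\<lambda>v. v $ j"]
    by (simp add: B_def signed_powr_signed_powr vector_matrix_mult_def sum.remove[of UNIV k] mult.commute)
  have "kkt_matrix (a * (p - 1)) k B l = A"
    using row_k \<open>l $ k \<noteq> 0\<close> by (auto simp: kkt_matrix_def vec_eq_iff B_def field_simps)
  moreover have "(\<chi> j. signed_powr a (B $ k $ j)) = x"
    using \<open>a > 0\<close> by (simp add: B_def signed_powr_signed_powr vec_eq_iff)
  ultimately have "kkt_chart a (a * (p - 1)) k (B, l) = (A, A *v x)"
    by (simp add: kkt_chart_def)
  moreover have "B $ k $ i = 0"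
    using \<open>x $ i = 0\<close> by (simp add: B_def)
  ultimately show ?thesis
    using \<open>l $ k \<noteq> 0\<close> by (intro image_eqI[of _ _ "(B, l)"]) simp_all
qed

lemma negligible_sparse_kkt_pairs:
  assumes "p > 1"
  shows "negligible (sparse_kkt_pairs p :: ((real ^ 'n ^ 'm) \<times> (real ^ 'm)) set)"
proof -
  define a where "a = max 1 (1 / (p - 1))"
  have "a \<ge> 1" "a * (p - 1) \<ge> 1"
    using assms by (auto simp: a_def max_def field_simps)
  define S where "S i k = kkt_chart a (a * (p - 1)) k `
    {z :: (real ^ 'n ^ 'm) \<times> (real ^ 'm). fst z $ k $ i = 0 \<and> snd z $ k \<noteq> 0}" for i k
  have "sparse_kkt_pairs p \<subseteq> (\<Union>i. \<Union>k. S i k)"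
  proof
    fix z :: "(real ^ 'n ^ 'm) \<times> (real ^ 'm)"
    assume "z \<in> sparse_kkt_pairs p"
    then obtain A :: "real ^ 'n ^ 'm" and x l i where z: "z = (A, A *v x)" and "l \<noteq> 0" "x $ i = 0"
      and kkt: "(\<chi> j. signed_powr (p - 1) (x $ j)) = l v* A"
      unfolding sparse_kkt_pairs_def by blast
    then obtain k where "l $ k \<noteq> 0"
      by (auto simp: vec_eq_iff)
    then have "z \<in> S i k"
      unfolding S_def z using \<open>a \<ge> 1\<close> \<open>x $ i = 0\<close> kkt by (intro sparse_kkt_pair_in_kkt_chart_image) auto
    then show "z \<in> (\<Union>i. \<Union>k. S i k)"
      by blast
  qed
  moreover have "negligible (S i k)" for i k
    unfolding S_def
  proof (rule negligible_differentiable_image_entry_slice)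
    show "kkt_chart a (a * (p - 1)) k differentiable_on {z. fst z $ k $ i = 0 \<and> snd z $ k \<noteq> 0}"
      using differentiable_on_kkt_chart[OF \<open>a \<ge> 1\<close> \<open>a * (p - 1) \<ge> 1\<close>, of k]
      by (rule differentiable_on_subset) auto
  next
    show "\<And>z. z \<in> {z. fst z $ k $ i = 0 \<and> snd z $ k \<noteq> 0} \<Longrightarrow> fst z $ k $ i = 0"
      by simp
  qed
  then have "negligible (\<Union>i. \<Union>k. S i k)"
    by (intro negligible_Union finite_imageI finite) auto
  ultimately show ?thesis
    by (rule negligible_subset[rotated])
qed

lemma lp_minimizer_full_support:
  fixes A :: "real ^ 'n ^ 'm"
  assumes "p > 1" "is_lp_minimizer p A x" "A *v x \<noteq> 0" "(A, A *v x) \<notin> sparse_kkt_pairs p"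
  shows "x $ i \<noteq> 0"
proof
  assume "x $ i = 0"
  obtain l where kkt: "(\<chi> j. signed_powr (p - 1) (x $ j)) = l v* A"
    using lp_minimizer_kkt[OF assms(1,2)] .
  have "l \<noteq> 0"
  proof
    assume "l = 0"
    then have "x = 0"
      using kkt by (simp add: vec_eq_iff vector_matrix_mult_def)
    then show False
      using assms(3) by simp
  qed
  then have "(A, A *v x) \<in> sparse_kkt_pairs p"
    unfolding sparse_kkt_pairs_def using kkt \<open>x $ i = 0\<close> by blast
  then show False
    using assms(4) by contradiction
qed

lemma lp_optimal_unique_full_support:
  fixes A :: "real ^ 'n ^ 'm"
  assumes "p > 1" "surj ((*v) A)" "y \<noteq> 0" "(A, y) \<notin> sparse_kkt_pairs p"
  shows "(\<exists>!x. lp_optimal p A y x) \<and> (\<forall>x. lp_optimal p A y x \<longrightarrow> supp x = UNIV)"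
proof -
  have "p > 0"
    using assms(1) by simp
  obtain x0 where "A *v x0 = y"
    using surjD[OF assms(2), of y] by auto
  moreover obtain x where "A *v x = A *v x0" "is_lp_minimizer p A x"
    using lp_minimizer_exists[OF \<open>p > 0\<close>] by blast
  ultimately have "A *v x = y" "is_lp_minimizer p A x"
    by simp_all
  then have "lp_optimal p A y x' \<longleftrightarrow> x' = x" for x'
    using lp_minimizer_unique[OF assms(1) \<open>is_lp_minimizer p A x\<close>, of x']
    unfolding lp_optimal_iff_is_lp_minimizer[OF \<open>p > 0\<close>] by auto
  moreover have "supp x = UNIV"
    using lp_minimizer_full_support[OF assms(1) \<open>is_lp_minimizer p A x\<close>] \<open>A *v x = y\<close> assms(3,4)
    by (auto simp: supp_def)
  ultimately show ?thesis
    by simp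
qed

theorem theorem4p1:
  fixes p :: real
  assumes "p > 1"
    and "CARD('n::finite) \<ge> 2 * CARD('m::finite) - 1"
  shows "AE Ay in (lborel :: ((real ^ 'n ^ 'm) \<times> (real ^ 'm)) measure).
           (\<exists>!x. lp_optimal p (fst Ay) (snd Ay) x) \<and>
           (\<forall>x. lp_optimal p (fst Ay) (snd Ay) x \<longrightarrow> card (supp x) = CARD('n))"
proof (rule AE_lborel_if_negligible)
  define N where "N = {z :: (real ^ 'n ^ 'm) \<times> (real ^ 'm). snd z = 0} \<union>
                      {z. \<not> surj ((*v) (fst z))} \<union> sparse_kkt_pairs p"
  have "CARD('m) \<le> CARD('n)" \<comment> \<open>the only use of the hypothesis N \<ge> 2m - 1\<close>
    using assms(2) by linarith
  then show "negligible N"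
    unfolding N_def
    by (intro negligible_Un negligible_snd_eq_0 negligible_non_surjective
        negligible_sparse_kkt_pairs assms(1))
  fix z
  assume "z \<notin> N"
  then show "(\<exists>!x. lp_optimal p (fst z) (snd z) x) \<and>
             (\<forall>x. lp_optimal p (fst z) (snd z) x \<longrightarrow> card (supp x) = CARD('n))"
    using lp_optimal_unique_full_support[OF assms(1), of "fst z" "snd z"] by (auto simp: N_def)
qed

end
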